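(* Let $G$ be a simple graph of order $n\geq 2$ with maximum degree $\Delta$ and minimum degree $\delta$. Then $$\frac{\sqrt{2}}{4\Delta}\, Alb(G)+\frac{1}{2}GA(G)\leq DSO(G) \leq \frac{1}{2\delta}Alb(G)+\frac{\sqrt{2}}{2}GA(G).$$ Equality on the left-hand side holds if and only if $G\simeq \overline{K_n}$ (the edgeless graph on $n$ vertices), and equality on the right-hand side holds if and only if $G$ consists of components each of which is a regular graph (not necessarily of equal degree).
   Context: For a simple graph $G=(V,E)$, $d_u$ denotes the degree of vertex $u$, and $uv\in E$ denotes an edge. The Diminished Sombor index is $DSO(G)=\sum_{uv\in E}\frac{\sqrt{d_u^2+d_v^2}}{d_u+d_v}$. The Albertson index is $Alb(G)=\sum_{uv\in E}|d_u-d_v|$. The geometric-arithmetic index is $GA(G)=\sum_{uv\in E}\frac{2\sqrt{d_ud_v}}{d_u+d_v}$. *)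

theory Defs
  imports Complex_Main "HOL-Library.Extended_Real"
begin

record 'a ugraph =
  verts :: "'a set"
  edges :: "'a set set"

definition simple_graph :: "'a ugraph \<Rightarrow> bool" where
  "simple_graph G \<longleftrightarrow>
     finite (verts G) \<and> (\<forall>e\<in>edges G. e \<subseteq> verts G \<and> card e = 2)"

definition degree :: "'a ugraph \<Rightarrow> 'a \<Rightarrow> nat" where
  "degree G v = card {e \<in> edges G. v \<in> e}"

definition max_degree :: "'a ugraph \<Rightarrow> nat" where
  "max_degree G = Max (degree G ` verts G)"

definition min_degree :: "'a ugraph \<Rightarrow> nat" where
  "min_degree G = Min (degree G ` verts G)"

text \<open>
  The sum of \<open>f d\<^sub>u d\<^sub>v\<close> over the edges \<open>uv\<close>, each edge being counted once. It is
  meaningful only for symmetric \<open>f\<close>, for which the description below does not depend on the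
  order in which the two ends of the edge are taken (see \<open>edge_value_eq\<close>).
\<close>

definition edge_value :: "'a ugraph \<Rightarrow> (real \<Rightarrow> real \<Rightarrow> real) \<Rightarrow> 'a set \<Rightarrow> real" where
  "edge_value G f e =
     (THE x. \<exists>u v. e = {u, v} \<and> x = f (real (degree G u)) (real (degree G v)))"

definition edge_sum :: "'a ugraph \<Rightarrow> (real \<Rightarrow> real \<Rightarrow> real) \<Rightarrow> real" where
  "edge_sum G f = (\<Sum>e\<in>edges G. edge_value G f e)"

lemma edge_value_eq:
  assumes "\<And>x y. f x y = f y x"
  shows "edge_value G f {u, v} = f (real (degree G u)) (real (degree G v))"
  unfolding edge_value_def
  by (rule the_equality) (use assms in \<open>auto simp: doubleton_eq_iff\<close>)

definition DSO :: "'a ugraph \<Rightarrow> real" where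
  "DSO G = edge_sum G (\<lambda>x y. sqrt (x\<^sup>2 + y\<^sup>2) / (x + y))"

definition Alb :: "'a ugraph \<Rightarrow> real" where
  "Alb G = edge_sum G (\<lambda>x y. \<bar>x - y\<bar>)"

definition GA :: "'a ugraph \<Rightarrow> real" where
  "GA G = edge_sum G (\<lambda>x y. 2 * sqrt (x * y) / (x + y))"

definition graph_iso :: "'a ugraph \<Rightarrow> 'b ugraph \<Rightarrow> bool" where
  "graph_iso G H \<longleftrightarrow>
     (\<exists>f. bij_betw f (verts G) (verts H) \<and>
          (\<forall>u\<in>verts G. \<forall>v\<in>verts G. {u, v} \<in> edges G \<longleftrightarrow> {f u, f v} \<in> edges H))"

definition complete_graph :: "nat \<Rightarrow> nat ugraph" where
  "complete_graph n = \<lparr>verts = {..<n}, edges = {e. e \<subseteq> {..<n} \<and> card e = 2}\<rparr>"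

definition complement_graph :: "'a ugraph \<Rightarrow> 'a ugraph" where
  "complement_graph G =
     \<lparr>verts = verts G, edges = {e. e \<subseteq> verts G \<and> card e = 2 \<and> e \<notin> edges G}\<rparr>"

definition induced_subgraph :: "'a ugraph \<Rightarrow> 'a set \<Rightarrow> 'a ugraph" where
  "induced_subgraph G W = \<lparr>verts = W, edges = {e \<in> edges G. e \<subseteq> W}\<rparr>"

definition connected_rel :: "'a ugraph \<Rightarrow> ('a \<times> 'a) set" where
  "connected_rel G =
     {(u, v). u \<in> verts G \<and> v \<in> verts G \<and> (u, v) \<in> {(x, y). {x, y} \<in> edges G}\<^sup>*}"

definition components :: "'a ugraph \<Rightarrow> 'a ugraph set" where
  "components G = induced_subgraph G ` (verts G // connected_rel G)"

definition regular :: "'a ugraph \<Rightarrow> bool" where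
  "regular G \<longleftrightarrow> (\<exists>k. \<forall>v\<in>verts G. degree G v = k)"

text \<open>
  The coefficients of \<open>Alb G\<close> have the maximum or the minimum degree in the denominator, and
  either may be zero. The bounds are therefore read in the extended reals, where a positive
  number divided by zero is \<open>\<infinity>\<close> and \<open>\<infinity> * 0 = 0\<close>. So a term with denominator zero vanishes
  if \<open>Alb G = 0\<close>, in particular for the edgeless graph, and is \<open>\<infinity>\<close> if \<open>Alb G > 0\<close>. When the
  degree is positive, the term is the ordinary real quotient.
\<close>

lemma coefficient_pos:
  assumes "d > 0"
  shows "ereal c / ereal d * ereal a = ereal (c / d * a)"
  using assms by simp

lemma coefficient_zero:
  assumes "c > 0"
  shows "ereal c / ereal 0 * ereal 0 = 0"
    and "a > 0 \<Longrightarrow> ereal c / ereal 0 * ereal a = \<infinity>"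
  using assms by (simp_all add: divide_ereal_def)

end

theory Submission
  imports Defs
begin

text \<open>
  Both bounds hold edge by edge. For an edge with end degrees \<open>x\<close> and \<open>y\<close>, the identity
  \<open>x\<^sup>2 + y\<^sup>2 = (x - y)\<^sup>2 + 2xy\<close> and \<open>2\<delta> \<le> x + y \<le> 2\<Delta>\<close> reduce them to
  \<open>sqrt (a + b) \<le> sqrt a + sqrt b \<le> sqrt (2 (a + b))\<close>: with \<open>a = (x - y)\<^sup>2\<close>, \<open>b = 2xy\<close> for the
  upper bound, and with \<open>a = (x - y)\<^sup>2 / 2\<close>, \<open>b = xy\<close> for the lower one. The upper bound is an
  equality exactly if \<open>x = y\<close>. The lower one is always strict: if \<open>x \<noteq> y\<close> then \<open>x + y < 2\<Delta>\<close>,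
  and if \<open>x = y\<close> it says \<open>1 / 2 < sqrt 2 / 2\<close>.
\<close>

section \<open>The inequalities for a single edge\<close>

lemma dso_term_upper:
  fixes x y d :: real
  assumes "x > 0" "y > 0" "d > 0" "2 * d \<le> x + y"
  shows "sqrt (x\<^sup>2 + y\<^sup>2) / (x + y)
           \<le> 1 / (2 * d) * \<bar>x - y\<bar> + sqrt 2 / 2 * (2 * sqrt (x * y) / (x + y))" (is "?L \<le> ?R")
    and "sqrt (x\<^sup>2 + y\<^sup>2) / (x + y)
           = 1 / (2 * d) * \<bar>x - y\<bar> + sqrt 2 / 2 * (2 * sqrt (x * y) / (x + y)) \<longleftrightarrow> x = y"
proof -
  have eq: "?L = ?R" if "x = y"
  proof -
    have "sqrt (x\<^sup>2 + y\<^sup>2) = sqrt 2 * x" "sqrt (x * y) = x"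
      using that assms by (simp_all flip: mult_2 add: real_sqrt_mult)
    then show ?thesis using that by simp
  qed
  have less: "?L < ?R" if "x \<noteq> y"
  proof -
    \<comment> \<open>Expanding the square gives the left side plus the cross term
      \<open>2 * sqrt 2 * \<bar>x - y\<bar> * sqrt (x * y)\<close>, which is positive since
      \<open>x \<noteq> y\<close>.\<close>
    have "x\<^sup>2 + y\<^sup>2 < (\<bar>x - y\<bar> + sqrt 2 * sqrt (x * y))\<^sup>2"
      using assms that by (simp add: power2_sum power_mult_distrib) (simp add: power2_diff)
    then have "sqrt (x\<^sup>2 + y\<^sup>2) < \<bar>x - y\<bar> + sqrt 2 * sqrt (x * y)"
      using assms by (intro real_less_lsqrt) auto
    then have "?L < (\<bar>x - y\<bar> + sqrt 2 * sqrt (x * y)) / (x + y)"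
      using assms by (intro divide_strict_right_mono) auto
    also have "\<dots> = \<bar>x - y\<bar> / (x + y) + sqrt 2 / 2 * (2 * sqrt (x * y) / (x + y))"
      by (simp add: add_divide_distrib)
    also have "\<bar>x - y\<bar> / (x + y) \<le> 1 / (2 * d) * \<bar>x - y\<bar>"
      using assms frac_le[of "\<bar>x - y\<bar>" "\<bar>x - y\<bar>" "2 * d" "x + y"] by simp
    finally show ?thesis by simp
  qed
  show "?L \<le> ?R" "?L = ?R \<longleftrightarrow> x = y"
    using eq less by (cases "x = y"; force)+
qed

lemma dso_term_lower:
  fixes x y D :: real
  assumes "x > 0" "y > 0" "x \<le> D" "y \<le> D"
  shows "sqrt 2 / (4 * D) * \<bar>x - y\<bar> + 1 / 2 * (2 * sqrt (x * y) / (x + y))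
           < sqrt (x\<^sup>2 + y\<^sup>2) / (x + y)"
proof (cases "x = y")
  case True
  have "sqrt (x\<^sup>2 + y\<^sup>2) = sqrt 2 * x" "sqrt (x * y) = x"
    using True assms by (simp_all flip: mult_2 add: real_sqrt_mult)
  then show ?thesis using True assms by simp
next
  case False
  \<comment> \<open>\<open>p\<close> and \<open>q\<close> are the square roots of
    \<open>(x - y)\<^sup>2 / 2\<close> and \<open>x * y\<close>; the Albertson term is then
    \<open>p / (2 * D)\<close> and the geometric-arithmetic term \<open>q / (x + y)\<close>.\<close>
  define p where "p = sqrt 2 / 2 * \<bar>x - y\<bar>"
  define q where "q = sqrt (x * y)"
  have pq: "p\<^sup>2 = (x - y)\<^sup>2 / 2" "q\<^sup>2 = x * y"
    using assms by (simp_all add: p_def q_def power_mult_distrib power_divide)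
  have "(p + q)\<^sup>2 \<le> 2 * (p\<^sup>2 + q\<^sup>2)"
    using sum_squares_bound[of p q] by (simp add: power2_sum)
  also have "\<dots> = x\<^sup>2 + y\<^sup>2"
    unfolding pq by (simp add: power2_diff field_simps)
  finally have pq_le: "p + q \<le> sqrt (x\<^sup>2 + y\<^sup>2)"
    by (rule real_le_rsqrt)
  have "sqrt 2 / (4 * D) * \<bar>x - y\<bar> = p / (2 * D)"
    by (simp add: p_def)
  also have "\<dots> < p / (x + y)"
    using assms False by (intro divide_strict_left_mono) (auto simp: p_def)
  finally have "sqrt 2 / (4 * D) * \<bar>x - y\<bar> + 1 / 2 * (2 * sqrt (x * y) / (x + y))
      < (p + q) / (x + y)"
    by (simp add: q_def add_divide_distrib)
  also have "\<dots> \<le> sqrt (x\<^sup>2 + y\<^sup>2) / (x + y)"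
    using pq_le assms by (intro divide_right_mono) auto
  finally show ?thesis .
qed

section \<open>Edges and degrees\<close>

lemma finite_edges:
  assumes "simple_graph G"
  shows "finite (edges G)"
  using assms by (auto simp: simple_graph_def intro: finite_subset[of _ "Pow (verts G)"])

lemma edgeE:
  assumes "simple_graph G" "e \<in> edges G"
  obtains u v where "e = {u, v}" "u \<noteq> v" "u \<in> verts G" "v \<in> verts G"
  using assms unfolding simple_graph_def by (metis card_2_iff insert_subset)

lemma edge_verts:
  assumes "simple_graph G" "{u, v} \<in> edges G"
  shows "u \<in> verts G" "v \<in> verts G"
  using assms by (auto simp: simple_graph_def)

lemma degree_pos:
  assumes "simple_graph G" "{u, v} \<in> edges G"
  shows "degree G u > 0" "degree G v > 0"
  using assms finite_edges[OF assms(1)] by (auto simp: degree_def card_gt_0_iff)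

lemma degree_bounds:
  assumes "simple_graph G" "v \<in> verts G"
  shows "min_degree G \<le> degree G v" "degree G v \<le> max_degree G"
  using assms by (auto simp: simple_graph_def min_degree_def max_degree_def)

section \<open>Sums over the edges\<close>

text \<open>Removes the definite description in \<open>edge_value\<close>: every edge is a pair, so
  prescribing \<open>g\<close> on pairs is enough.\<close>

lemma edge_sum_eq_sum:
  assumes "simple_graph G" and f: "\<And>x y. f x y = f y x"
    and g: "\<And>u v. {u, v} \<in> edges G \<Longrightarrow> g {u, v} = f (real (degree G u)) (real (degree G v))"
  shows "edge_sum G f = (\<Sum>e\<in>edges G. g e)"
  unfolding edge_sum_def
proof (rule sum.cong[OF refl])
  fix e assume "e \<in> edges G"
  then show "edge_value G f e = g e"
    using edgeE[OF assms(1)] edge_value_eq[of f, OF f] g by metis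
qed

lemma edge_sum_linear:
  assumes "simple_graph G" "\<And>x y. f x y = f y x" "\<And>x y. g x y = g y x"
  shows "edge_sum G (\<lambda>x y. a * f x y + b * g x y) = a * edge_sum G f + b * edge_sum G g"
proof -
  have "edge_sum G (\<lambda>x y. a * f x y + b * g x y)
      = (\<Sum>e\<in>edges G. a * edge_value G f e + b * edge_value G g e)"
  proof (rule edge_sum_eq_sum[OF assms(1)])
    show "a * f x y + b * g x y = a * f y x + b * g y x" for x y
      using assms(2,3) by metis
  qed (simp add: edge_value_eq[of f, OF assms(2)] edge_value_eq[of g, OF assms(3)])
  then show ?thesis
    by (simp add: edge_sum_def sum.distrib sum_distrib_left)
qed

text \<open>Carries the edgewise bounds and their equality cases over to the graph: a finite sum of
  nonnegative differences vanishes only if each difference does.\<close>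

lemma edge_sum_mono:
  assumes "simple_graph G" and f: "\<And>x y. f x y = f y x" and g: "\<And>x y. g x y = g y x"
    and le: "\<And>u v. {u, v} \<in> edges G \<Longrightarrow>
      f (real (degree G u)) (real (degree G v)) \<le> g (real (degree G u)) (real (degree G v))"
  shows "edge_sum G f \<le> edge_sum G g"
    and "edge_sum G f = edge_sum G g \<longleftrightarrow> (\<forall>u v. {u, v} \<in> edges G \<longrightarrow>
      f (real (degree G u)) (real (degree G v)) = g (real (degree G u)) (real (degree G v)))"
proof -
  have le': "edge_value G f e \<le> edge_value G g e" if "e \<in> edges G" for e
    using edgeE[OF assms(1) that] edge_value_eq[of f, OF f] edge_value_eq[of g, OF g] le that
    by metis
  then show "edge_sum G f \<le> edge_sum G g"
    unfolding edge_sum_def by (rule sum_mono)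
  have "edge_sum G f = edge_sum G g \<longleftrightarrow> (\<Sum>e\<in>edges G. edge_value G g e - edge_value G f e) = 0"
    by (auto simp: edge_sum_def sum_subtractf)
  also have "\<dots> \<longleftrightarrow> (\<forall>e\<in>edges G. edge_value G g e - edge_value G f e = 0)"
    using le' by (intro sum_nonneg_eq_0_iff finite_edges assms(1)) auto
  also have "\<dots> \<longleftrightarrow> (\<forall>u v. {u, v} \<in> edges G \<longrightarrow> edge_value G f {u, v} = edge_value G g {u, v})"
    using edgeE[OF assms(1)] by (metis diff_eq_eq add_0)
  finally show "edge_sum G f = edge_sum G g \<longleftrightarrow> (\<forall>u v. {u, v} \<in> edges G \<longrightarrow>
      f (real (degree G u)) (real (degree G v)) = g (real (degree G u)) (real (degree G v)))"
    by (simp add: edge_value_eq[of f, OF f] edge_value_eq[of g, OF g])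
qed

text \<open>Comparison with the zero function. The edge condition obtained here is also the one for
  equality in the upper bound, and it decides what a term with denominator zero means.\<close>

lemma Alb_nonneg:
  assumes "simple_graph G"
  shows "Alb G \<ge> 0"
    and "Alb G = 0 \<longleftrightarrow> (\<forall>u v. {u, v} \<in> edges G \<longrightarrow> degree G u = degree G v)"
proof -
  have 0: "edge_sum G (\<lambda>x y. 0) = 0"
    using edge_sum_eq_sum[OF assms, of "\<lambda>x y. 0" "\<lambda>e. 0"] by simp
  note * = edge_sum_mono[OF assms, of "\<lambda>x y. 0" "\<lambda>x y. \<bar>x - y\<bar>", unfolded 0, folded Alb_def]
  show "Alb G \<ge> 0" by (rule *(1)) auto
  have "0 = Alb G \<longleftrightarrow> (\<forall>u v. {u, v} \<in> edges G \<longrightarrow> 0 = \<bar>real (degree G u) - real (degree G v)\<bar>)"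
    by (rule *(2)) auto
  then show "Alb G = 0 \<longleftrightarrow> (\<forall>u v. {u, v} \<in> edges G \<longrightarrow> degree G u = degree G v)"
    by auto
qed

section \<open>The bounds with real coefficients\<close>

text \<open>Strictness on every edge leaves equality only for the empty sum. If the maximum degree
  is zero there are no edges, and all terms are zero.\<close>

lemma DSO_lower:
  assumes "simple_graph G"
  shows "sqrt 2 / (4 * real (max_degree G)) * Alb G + 1 / 2 * GA G \<le> DSO G"
    and "sqrt 2 / (4 * real (max_degree G)) * Alb G + 1 / 2 * GA G = DSO G \<longleftrightarrow> edges G = {}"
proof -
  let ?D = "real (max_degree G)"
  let ?h = "\<lambda>x y. sqrt 2 / (4 * ?D) * \<bar>x - y\<bar> + 1 / 2 * (2 * sqrt (x * y) / (x + y))"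
  have sum: "sqrt 2 / (4 * ?D) * Alb G + 1 / 2 * GA G = edge_sum G ?h"
    unfolding Alb_def GA_def by (rule edge_sum_linear[OF assms, symmetric]) (auto simp: ac_simps)
  have less: "?h (real (degree G u)) (real (degree G v))
      < sqrt ((real (degree G u))\<^sup>2 + (real (degree G v))\<^sup>2) / (real (degree G u) + real (degree G v))"
    if "{u, v} \<in> edges G" for u v
    using degree_pos[OF assms that] degree_bounds(2)[OF assms] edge_verts[OF assms that]
    by (intro dso_term_lower) auto
  show "sqrt 2 / (4 * ?D) * Alb G + 1 / 2 * GA G \<le> DSO G"
    unfolding sum DSO_def
    by (rule edge_sum_mono(1)[OF assms]) (use less in \<open>auto simp: ac_simps less_imp_le\<close>)
  have "edge_sum G ?h = DSO G \<longleftrightarrow> (\<forall>u v. {u, v} \<in> edges G \<longrightarrow>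
      ?h (real (degree G u)) (real (degree G v))
      = sqrt ((real (degree G u))\<^sup>2 + (real (degree G v))\<^sup>2) / (real (degree G u) + real (degree G v)))"
    unfolding DSO_def
    by (rule edge_sum_mono(2)[OF assms]) (use less in \<open>auto simp: ac_simps less_imp_le\<close>)
  also have "\<dots> \<longleftrightarrow> (\<forall>u v. {u, v} \<notin> edges G)"
    using less by (metis less_irrefl)
  also have "\<dots> \<longleftrightarrow> edges G = {}"
    using edgeE[OF assms] by (metis all_not_in_conv)
  finally show "sqrt 2 / (4 * ?D) * Alb G + 1 / 2 * GA G = DSO G \<longleftrightarrow> edges G = {}"
    unfolding sum .
qed

text \<open>The bound \<open>d\<close> is a parameter because it is used twice: with the minimum
  degree if that is positive, and with \<open>1\<close> otherwise.\<close>

lemma DSO_upper: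
  assumes "simple_graph G" and d: "d > 0"
    and le: "\<And>u v. {u, v} \<in> edges G \<Longrightarrow> 2 * d \<le> real (degree G u) + real (degree G v)"
  shows "DSO G \<le> 1 / (2 * d) * Alb G + sqrt 2 / 2 * GA G"
    and "DSO G = 1 / (2 * d) * Alb G + sqrt 2 / 2 * GA G
      \<longleftrightarrow> (\<forall>u v. {u, v} \<in> edges G \<longrightarrow> degree G u = degree G v)"
proof -
  let ?h = "\<lambda>x y. 1 / (2 * d) * \<bar>x - y\<bar> + sqrt 2 / 2 * (2 * sqrt (x * y) / (x + y))"
  have sum: "1 / (2 * d) * Alb G + sqrt 2 / 2 * GA G = edge_sum G ?h"
    unfolding Alb_def GA_def by (rule edge_sum_linear[OF assms(1), symmetric]) (auto simp: ac_simps)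
  have pos: "real (degree G u) > 0" "real (degree G v) > 0" if "{u, v} \<in> edges G" for u v
    using degree_pos[OF assms(1) that] by auto
  have less_eq: "sqrt ((real (degree G u))\<^sup>2 + (real (degree G v))\<^sup>2) / (real (degree G u) + real (degree G v))
      \<le> ?h (real (degree G u)) (real (degree G v))" if "{u, v} \<in> edges G" for u v
    by (rule dso_term_upper(1)[OF pos[OF that] d le[OF that]])
  show "DSO G \<le> 1 / (2 * d) * Alb G + sqrt 2 / 2 * GA G"
    unfolding sum DSO_def
    by (rule edge_sum_mono(1)[OF assms(1)])
      (use less_eq in \<open>auto simp: ac_simps\<close>)
  have "DSO G = edge_sum G ?h \<longleftrightarrow> (\<forall>u v. {u, v} \<in> edges G \<longrightarrow>
      sqrt ((real (degree G u))\<^sup>2 + (real (degree G v))\<^sup>2) / (real (degree G u) + real (degree G v))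
      = ?h (real (degree G u)) (real (degree G v)))"
    unfolding DSO_def
    by (rule edge_sum_mono(2)[OF assms(1)])
      (use less_eq in \<open>auto simp: ac_simps\<close>)
  also have "\<dots> \<longleftrightarrow> (\<forall>u v. {u, v} \<in> edges G \<longrightarrow> degree G u = degree G v)"
    using dso_term_upper(2)[OF pos d le] by (metis of_nat_eq_iff)
  finally show "DSO G = 1 / (2 * d) * Alb G + sqrt 2 / 2 * GA G
      \<longleftrightarrow> (\<forall>u v. {u, v} \<in> edges G \<longrightarrow> degree G u = degree G v)"
    unfolding sum .
qed

section \<open>The equality cases as properties of the graph\<close>

lemma graph_iso_edgeless_iff:
  assumes "simple_graph G" "card (verts G) = n"
  shows "graph_iso G (complement_graph (complete_graph n)) \<longleftrightarrow> edges G = {}"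
proof -
  have H: "complement_graph (complete_graph n) = \<lparr>verts = {..<n}, edges = {}\<rparr>"
    by (auto simp: complement_graph_def complete_graph_def)
  have "\<exists>f. bij_betw f (verts G) {..<n}"
    using assms by (auto simp: simple_graph_def intro: finite_same_card_bij)
  then have "graph_iso G (complement_graph (complete_graph n))
      \<longleftrightarrow> (\<forall>u\<in>verts G. \<forall>v\<in>verts G. {u, v} \<notin> edges G)"
    by (simp add: graph_iso_def H)
  also have "\<dots> \<longleftrightarrow> edges G = {}"
    using edgeE[OF assms(1)] by (metis all_not_in_conv)
  finally show ?thesis .
qed

text \<open>Degrees that agree across each edge agree along paths, hence on a component; conversely,
  both ends of an edge lie in one component.\<close>

lemma components_regular_iff:
  assumes "simple_graph G"
  shows "(\<forall>H\<in>components G. regular H)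
    \<longleftrightarrow> (\<forall>u v. {u, v} \<in> edges G \<longrightarrow> degree G u = degree G v)"
proof -
  define R where "R = connected_rel G"
  have edge_R: "(u, v) \<in> R" if "{u, v} \<in> edges G" for u v
    using that edge_verts[OF assms that] by (auto simp: R_def connected_rel_def)
  have refl_R: "(u, u) \<in> R" if "u \<in> verts G" for u
    using that by (auto simp: R_def connected_rel_def)
  have trans_R: "(u, w) \<in> R" if "(u, v) \<in> R" "(v, w) \<in> R" for u v w
    using that by (auto simp: R_def connected_rel_def)
  \<comment> \<open>A component contains every edge of \<open>G\<close> at each of its vertices, so
    restricting to it changes no degree.\<close>
  have deg: "degree (induced_subgraph G (R `` {w})) v = degree G v" if v: "v \<in> R `` {w}" for v w
  proof -
    have "e \<subseteq> R `` {w}" if e: "e \<in> edges G" "v \<in> e" for e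
    proof
      fix x assume x: "x \<in> e"
      have "x = v \<or> e = {v, x}"
        using edgeE[OF assms e(1)] e(2) x by (metis insert_commute insertE singletonD)
      then show "x \<in> R `` {w}"
        using v e(1) edge_R trans_R by (metis Image_singleton_iff)
    qed
    then show ?thesis
      by (auto simp: degree_def induced_subgraph_def intro!: arg_cong[where f = card])
  qed
  have "(\<forall>H\<in>components G. regular H)
      \<longleftrightarrow> (\<forall>w\<in>verts G. \<exists>k. \<forall>v\<in>R `` {w}. degree (induced_subgraph G (R `` {w})) v = k)"
    by (auto simp: components_def quotient_def regular_def induced_subgraph_def R_def)
  also have "\<dots> \<longleftrightarrow> (\<forall>w\<in>verts G. \<exists>k. \<forall>v\<in>R `` {w}. degree G v = k)"
    by (simp add: deg del: Image_singleton_iff cong: ball_cong)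
  also have "\<dots> \<longleftrightarrow> (\<forall>u v. {u, v} \<in> edges G \<longrightarrow> degree G u = degree G v)"
  proof safe
    fix u v
    assume *: "\<forall>w\<in>verts G. \<exists>k. \<forall>v\<in>R `` {w}. degree G v = k" and e: "{u, v} \<in> edges G"
    have "u \<in> R `` {u}" "v \<in> R `` {u}"
      using edge_R[OF e] refl_R edge_verts[OF assms e] by auto
    then show "degree G u = degree G v"
      using * edge_verts[OF assms e] by metis
  next
    fix w
    assume *: "\<forall>u v. {u, v} \<in> edges G \<longrightarrow> degree G u = degree G v"
    have "degree G v = degree G w" if "v \<in> R `` {w}" for v
    proof -
      have "(w, v) \<in> {(x, y). {x, y} \<in> edges G}\<^sup>*"
        using that by (auto simp: R_def connected_rel_def)
      then show ?thesis
        by induction (use * in auto)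
    qed
    then show "\<exists>k. \<forall>v\<in>R `` {w}. degree G v = k" by blast
  qed
  finally show ?thesis .
qed

section \<open>The bounds in the extended reals\<close>

theorem theorem3p1:
  fixes G :: "'a ugraph" and n \<Delta> \<delta> :: nat
  assumes "simple_graph G"
    and "card (verts G) = n"
    and "n \<ge> 2"
    and "\<Delta> = max_degree G"
    and "\<delta> = min_degree G"
  shows "(ereal (sqrt 2) / ereal (4 * real \<Delta>) * ereal (Alb G) + ereal (1 / 2 * GA G)
           \<le> ereal (DSO G))
       \<and> (ereal (DSO G)
           \<le> ereal 1 / ereal (2 * real \<delta>) * ereal (Alb G) + ereal (sqrt 2 / 2 * GA G))
       \<and> (ereal (sqrt 2) / ereal (4 * real \<Delta>) * ereal (Alb G) + ereal (1 / 2 * GA G)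
           = ereal (DSO G)
         \<longleftrightarrow> graph_iso G (complement_graph (complete_graph n)))
       \<and> (ereal (DSO G)
           = ereal 1 / ereal (2 * real \<delta>) * ereal (Alb G) + ereal (sqrt 2 / 2 * GA G)
         \<longleftrightarrow> (\<forall>H\<in>components G. regular H))"
proof -
  note G = assms(1)
  \<comment> \<open>If \<open>\<Delta> = 0\<close> then \<open>Alb G = 0\<close>, and the term is
    zero under both conventions: \<open>\<infinity> * 0 = 0\<close> in the extended reals and
    division by zero giving \<open>0\<close> in the reals.\<close>
  have lower: "ereal (sqrt 2) / ereal (4 * real \<Delta>) * ereal (Alb G) + ereal (1 / 2 * GA G)
      = ereal (sqrt 2 / (4 * real (max_degree G)) * Alb G + 1 / 2 * GA G)"
  proof (cases "\<Delta> = 0")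
    case True
    have "degree G u = 0" if "u \<in> verts G" for u
      using degree_bounds(2)[OF G that] True assms(4) by simp
    then have "Alb G = 0"
      using Alb_nonneg(2)[OF G] edge_verts[OF G] by metis
    then show ?thesis
      by (simp add: zero_ereal_def[symmetric])
  next
    case False
    then show ?thesis
      using assms(4) by simp
  qed
  have "ereal (DSO G)
           \<le> ereal 1 / ereal (2 * real \<delta>) * ereal (Alb G) + ereal (sqrt 2 / 2 * GA G)
       \<and> (ereal (DSO G)
           = ereal 1 / ereal (2 * real \<delta>) * ereal (Alb G) + ereal (sqrt 2 / 2 * GA G)
         \<longleftrightarrow> (\<forall>u v. {u, v} \<in> edges G \<longrightarrow> degree G u = degree G v))"
  proof (cases "\<delta> = 0")
    case False
    have "2 * real \<delta> \<le> real (degree G u) + real (degree G v)" if "{u, v} \<in> edges G" for u v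
      using degree_bounds(1)[OF G] edge_verts[OF G that] assms(5)
      by (smt (verit) of_nat_le_iff)
    then show ?thesis
      using DSO_upper[OF G, of "real \<delta>"] False by simp
  next
    case True
    show ?thesis
    proof (cases "Alb G = 0")
      case Alb: True
      \<comment> \<open>Isolated vertices make \<open>\<delta>\<close> zero, but the ends of an edge
        have degree at least \<open>1\<close>. As \<open>Alb G = 0\<close>, replacing the
        coefficient by that for \<open>d = 1\<close> changes nothing.\<close>
      have "2 * 1 \<le> real (degree G u) + real (degree G v)" if "{u, v} \<in> edges G" for u v
        using degree_pos[OF G that] by simp
      then have "DSO G = sqrt 2 / 2 * GA G"
        using DSO_upper(2)[OF G, of 1] Alb Alb_nonneg(2)[OF G] by simp
      then show ?thesis
        using Alb Alb_nonneg(2)[OF G] by (simp add: zero_ereal_def[symmetric])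
    next
      case False
      \<comment> \<open>The right side is infinite, so the bound is strict; and some edge has ends
        of different degrees, so both sides of the equivalence are false.\<close>
      then have "Alb G > 0" using Alb_nonneg(1)[OF G] by simp
      then have "ereal 1 / ereal (2 * real \<delta>) * ereal (Alb G) = \<infinity>"
        using True coefficient_zero(2)[of 1] by simp
      then show ?thesis
        using False Alb_nonneg(2)[OF G] by simp
    qed
  qed
  then show ?thesis
    unfolding lower components_regular_iff[OF G] graph_iso_edgeless_iff[OF G assms(2)]
    using DSO_lower[OF G] by simp
qed

end
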